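(* The cycle $C_7$ is not thrifty, is not greedy, and satisfies $c_r(C_7)>2^d$, where $d=3$ is the diameter of $C_7$.
   Context: A pebbling distribution assigns to each vertex a non-negative integer number of pebbles; a rooted distribution fixes a root $r$. A pebbling step $[a,b]$, for adjacent $a,b$, removes two pebbles from $a$ and adds one to $b$; it is greedy if $d(a,r)>d(b,r)$ ($d$ = graph distance). A rooted distribution is $r$-solvable if some sequence of pebbling steps (a solution) ends with at least one pebble on $r$; it is greedy if it has a solution using only greedy steps; it is $r$-critical if it is $r$-solvable but removing any single pebble makes it not $r$-solvable. The pebbling number $p(G)$ is the minimum number such that every distribution with $p(G)$ pebbles is $r$-solvable for every $r$. A graph $G$ is greedy if every rooted distribution (for every root) with at least $p(G)$ pebbles is greedy. $c_r(G)$ is the largest size of an $r$-critical rooted distribution on $G$ over all roots; an $r$-ceiling distribution is an $r$-critical rooted distribution with exactly $c_r(G)$ pebbles; $G$ is thrifty if every $r$-ceiling distribution is greedy. *)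

theory Defs
  imports "Graph_Theory.Graph_Theory"
begin

text \<open>
  A finite simple undirected graph is a \<^locale>\<open>pair_graph\<close>: every edge is represented by its two
  orientations, so \<open>(a, b) \<in> parcs G\<close> says that \<open>a\<close> and \<open>b\<close> are adjacent.
\<close>

definition cycle_graph :: "nat \<Rightarrow> nat pair_pre_digraph" where
  "cycle_graph n = \<lparr> pverts = {..<n},
     parcs = {(i, j). i < n \<and> j < n \<and> (j = Suc i mod n \<or> i = Suc j mod n)} \<rparr>"

lemma pair_graph_cycle_graph:
  assumes "n \<ge> 3"
  shows "pair_graph (cycle_graph n)"
proof
  have "parcs (cycle_graph n) \<subseteq> {..<n} \<times> {..<n}"
    by (auto simp: cycle_graph_def)
  then show "finite (parcs (cycle_graph n))"
    by (rule finite_subset) simp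
  show "symmetric (with_proj (cycle_graph n))"
    by (auto simp: symmetric_def cycle_graph_def intro: symI)
  show "fst e \<noteq> snd e" if "e \<in> parcs (cycle_graph n)" for e
    using that assms by (auto simp: cycle_graph_def mod_Suc split: if_splits)
qed (auto simp: cycle_graph_def)

text \<open>The graph distance is the least cost of a walk in which each edge costs 1
  (\<open>\<infinity>\<close> between different components).\<close>

definition graph_dist :: "'a pair_pre_digraph \<Rightarrow> 'a \<Rightarrow> 'a \<Rightarrow> ereal" where
  "graph_dist G u v = wf_digraph.\<mu> (with_proj G) (\<lambda>_. 1) u v"

definition graph_diameter :: "'a pair_pre_digraph \<Rightarrow> ereal" where
  "graph_diameter G = (SUP (u, v) \<in> pverts G \<times> pverts G. graph_dist G u v)"

definition distribution :: "'a pair_pre_digraph \<Rightarrow> ('a \<Rightarrow> nat) \<Rightarrow> bool" where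
  "distribution G D \<longleftrightarrow> (\<forall>v. v \<notin> pverts G \<longrightarrow> D v = 0)"

definition num_pebbles :: "'a pair_pre_digraph \<Rightarrow> ('a \<Rightarrow> nat) \<Rightarrow> nat" where
  "num_pebbles G D = (\<Sum>v\<in>pverts G. D v)"

definition pebbling_step ::
  "'a pair_pre_digraph \<Rightarrow> 'a \<Rightarrow> 'a \<Rightarrow> ('a \<Rightarrow> nat) \<Rightarrow> ('a \<Rightarrow> nat) \<Rightarrow> bool" where
  "pebbling_step G a b D D' \<longleftrightarrow>
     (a, b) \<in> parcs G \<and> 2 \<le> D a \<and> D' = D(a := D a - 2, b := D b + 1)"

definition greedy_step ::
  "'a pair_pre_digraph \<Rightarrow> 'a \<Rightarrow> 'a \<Rightarrow> 'a \<Rightarrow> ('a \<Rightarrow> nat) \<Rightarrow> ('a \<Rightarrow> nat) \<Rightarrow> bool" where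
  "greedy_step G r a b D D' \<longleftrightarrow>
     pebbling_step G a b D D' \<and> graph_dist G a r > graph_dist G b r"

definition solvable :: "'a pair_pre_digraph \<Rightarrow> 'a \<Rightarrow> ('a \<Rightarrow> nat) \<Rightarrow> bool" where
  "solvable G r D \<longleftrightarrow>
     (\<exists>D'. (\<lambda>E E'. \<exists>a b. pebbling_step G a b E E')\<^sup>*\<^sup>* D D' \<and> 1 \<le> D' r)"

definition greedy_distribution :: "'a pair_pre_digraph \<Rightarrow> 'a \<Rightarrow> ('a \<Rightarrow> nat) \<Rightarrow> bool" where
  "greedy_distribution G r D \<longleftrightarrow>
     (\<exists>D'. (\<lambda>E E'. \<exists>a b. greedy_step G r a b E E')\<^sup>*\<^sup>* D D' \<and> 1 \<le> D' r)"

definition critical :: "'a pair_pre_digraph \<Rightarrow> 'a \<Rightarrow> ('a \<Rightarrow> nat) \<Rightarrow> bool" where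
  "critical G r D \<longleftrightarrow> distribution G D \<and> solvable G r D \<and>
     (\<forall>v. 1 \<le> D v \<longrightarrow> \<not> solvable G r (D(v := D v - 1)))"

definition pebbling_number :: "'a pair_pre_digraph \<Rightarrow> nat" where
  "pebbling_number G =
     (LEAST n. \<forall>D. distribution G D \<and> num_pebbles G D = n \<longrightarrow> (\<forall>r\<in>pverts G. solvable G r D))"

definition greedy_graph :: "'a pair_pre_digraph \<Rightarrow> bool" where
  "greedy_graph G \<longleftrightarrow>
     (\<forall>r\<in>pverts G. \<forall>D. distribution G D \<and> pebbling_number G \<le> num_pebbles G D \<longrightarrow>
        greedy_distribution G r D)"

text \<open>The number \<open>c\<^sub>r(G)\<close>: the subscript is part of the name, the maximum ranges over all roots.\<close>

definition critical_number :: "'a pair_pre_digraph \<Rightarrow> nat" where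
  "critical_number G = Max {num_pebbles G D | D r. r \<in> pverts G \<and> critical G r D}"

definition ceiling_distribution :: "'a pair_pre_digraph \<Rightarrow> 'a \<Rightarrow> ('a \<Rightarrow> nat) \<Rightarrow> bool" where
  "ceiling_distribution G r D \<longleftrightarrow> critical G r D \<and> num_pebbles G D = critical_number G"

definition thrifty :: "'a pair_pre_digraph \<Rightarrow> bool" where
  "thrifty G \<longleftrightarrow>
     (\<forall>r\<in>pverts G. \<forall>D. ceiling_distribution G r D \<longrightarrow> greedy_distribution G r D)"

end

theory Submission
  imports Defs
begin

text \<open>
  Fix a root \<open>r\<close> of the seven-cycle and number the vertices \<open>0, \<dots>, 6\<close> from it. Give a pebble at
  vertex \<open>k\<close> the weight \<open>2\<^sup>6\<^sup>-\<^sup>k\<close>, and in the opposite direction the weight \<open>2\<^sup>k\<^sup>-\<^sup>1\<close> (with weight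
  \<open>64\<close> on the root in both cases). A distribution is \<open>r\<close>-solvable iff one of the two total weights
  is at least \<open>64\<close>: pebbles can be pushed along the whole path, and conversely no step between
  non-root vertices increases either weight. This turns solvability into linear arithmetic, which
  shows that among eleven pebbles one is always redundant, so the pebbling number is at most
  \<open>11\<close> and critical distributions have at most \<open>10\<close> pebbles. Placing \<open>6\<close> and \<open>4\<close> pebbles on
  the two vertices opposite the root is critical, hence a ceiling distribution, but greedy steps
  never use the edge between these two vertices and \<open>8\<close> pebbles on one of them would be needed.
  For the same reason \<open>7\<close> and \<open>4\<close> pebbles there show that the cycle is not greedy.
\<close>

section \<open>Path weights and pushing pebbles along a path\<close>

text \<open>A path is listed towards its end, so the last vertex has the largest coefficient,
  \<open>2 ^ (length vs - 1)\<close>: the weight at which one pebble reaches it.\<close>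

fun path_weight :: "('a \<Rightarrow> nat) \<Rightarrow> 'a list \<Rightarrow> nat" where
  "path_weight D [] = 0"
| "path_weight D (v # vs) = D v + 2 * path_weight D vs"

lemma path_weight_mono:
  assumes "\<And>v. v \<in> set vs \<Longrightarrow> D v \<le> E v"
  shows "path_weight D vs \<le> path_weight E vs"
  using assms by (induction vs) (auto intro: add_mono)

lemma path_weight_cong:
  assumes "\<And>v. v \<in> set vs \<Longrightarrow> D v = E v"
  shows "path_weight D vs = path_weight E vs"
  using assms by (induction vs) auto

lemma path_weight_map: "path_weight D (map f vs) = path_weight (D \<circ> f) vs"
  by (induction vs) auto

lemma solvable_converse_pebbling_step:
  assumes "(\<lambda>E E'. \<exists>a b. pebbling_step G a b E E')\<^sup>*\<^sup>* D E" "solvable G r E"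
  shows "solvable G r D"
  using assms unfolding solvable_def by (meson rtranclp_trans)

lemma pebbling_steps_along_arc:
  assumes "(a, b) \<in> parcs G" "a \<noteq> b" "2 * k \<le> D a"
  shows "(\<lambda>E E'. \<exists>a b. pebbling_step G a b E E')\<^sup>*\<^sup>* D (D(a := D a - 2 * k, b := D b + k))"
  using assms(3)
proof (induction k)
  case 0
  then show ?case by simp
next
  case (Suc k)
  let ?E = "D(a := D a - 2 * k, b := D b + k)"
  let ?F = "D(a := D a - 2 * Suc k, b := D b + Suc k)"
  have "pebbling_step G a b ?E ?F"
    using assms(1,2) Suc.prems by (auto simp: pebbling_step_def fun_eq_iff)
  moreover have "(\<lambda>E E'. \<exists>a b. pebbling_step G a b E E')\<^sup>*\<^sup>* D ?E"
    using Suc.prems by (intro Suc.IH) simp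
  ultimately show ?case
    by (blast intro: rtranclp.rtrancl_into_rtrancl)
qed

text \<open>Pushing as many pebbles as possible along the path costs only the nested floors, and
  these compose to a single one; hence the threshold is exact.\<close>

lemma solvable_path:
  assumes "successively (\<lambda>a b. (a, b) \<in> parcs G) vs" "distinct vs" "vs \<noteq> []"
    and "2 ^ (length vs - 1) \<le> path_weight D vs"
  shows "solvable G (last vs) D"
  using assms
proof (induction vs arbitrary: D rule: induct_list012)
  case (2 v)
  then show ?case by (auto simp: solvable_def)
next
  case (3 v w vs)
  let ?k = "D v div 2"
  let ?E = "D(v := D v - 2 * ?k, w := D w + ?k)"
  have "path_weight ?E vs = path_weight D vs"
    using 3(4) by (intro path_weight_cong) auto
  then have "path_weight ?E (w # vs) = ?k + path_weight D (w # vs)"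
    by (simp del: fun_upd_apply add: fun_upd_same)
  \<comment> \<open>The threshold and \<open>2 * path_weight D (w # vs)\<close> are both even, so
    halving with the floor \<open>D v div 2\<close> loses nothing.\<close>
  also have "\<dots> \<ge> 2 ^ length vs"
    using 3(6) by simp
  finally have "solvable G (last (w # vs)) ?E"
    using 3(3,4) \<open>2 ^ length vs \<le> _\<close> by (intro 3(2)) (simp_all del: fun_upd_apply)
  moreover have "(\<lambda>E E'. \<exists>a b. pebbling_step G a b E E')\<^sup>*\<^sup>* D ?E"
    using 3 by (intro pebbling_steps_along_arc) auto
  ultimately show ?case
    using solvable_converse_pebbling_step by fastforce
qed simp

section \<open>Distances\<close>

lemma graph_dist_le_relpow:
  assumes "pair_wf_digraph G" "v \<in> pverts G" "(u, v) \<in> parcs G ^^ k"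
  shows "graph_dist G u v \<le> real k"
proof -
  interpret pair_wf_digraph G by fact
  have "\<exists>p. awalk u p v \<and> length p = k"
    using assms(3)
  proof (induction k arbitrary: u)
    case 0
    then show ?case
      using assms(2) by (auto intro!: exI[of _ "[]"] simp: awalk_Nil_iff)
  next
    case (Suc k)
    then obtain w p where "(u, w) \<in> parcs G" "awalk w p v" "length p = k"
      by (meson relpow_Suc_D2)
    then show ?case
      by (intro exI[of _ "(u, w) # p"]) (auto simp: awalk_Cons_iff)
  qed
  then obtain p where p: "awalk u p v" "length p = k" by blast
  have "awalk_cost (\<lambda>_. 1) p = real k"
    using p(2) by (simp add: awalk_cost_def sum_list_triv)
  with min_cost_le_walk_cost[OF p(1), of "\<lambda>_. 1"] show ?thesis
    by (simp add: graph_dist_def)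
qed

text \<open>Since \<open>h\<close> drops by at most one along each arc, every walk has at least
  \<open>h u - h v\<close> edges, and the infimum inherits this bound.\<close>

lemma graph_dist_ge_potential:
  assumes "pair_wf_digraph G" "\<And>a b. (a, b) \<in> parcs G \<Longrightarrow> h a \<le> Suc (h b)"
  shows "real (h u) \<le> graph_dist G u v + real (h v)"
proof -
  interpret pair_wf_digraph G by fact
  have *: "h u \<le> h v + length p" if "awalk u p v" for p
    using that
  proof (induction p arbitrary: u)
    case (Cons e p)
    then have "e \<in> parcs G" "u = fst e" "h (snd e) \<le> h v + length p"
      by (auto simp: awalk_Cons_iff)
    then show ?case
      using assms(2)[of "fst e" "snd e"] by auto
  qed (simp add: awalk_Nil_iff)
  have "ereal (real (h u) - real (h v)) \<le> graph_dist G u v"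
    unfolding graph_dist_def \<mu>_def
  proof (rule INF_greatest)
    fix p assume "p \<in> {p. awalk u p v}"
    then have "real (h u) - real (h v) \<le> real (length p)"
      using * by fastforce
    then show "ereal (real (h u) - real (h v)) \<le> ereal (awalk_cost (\<lambda>_. 1) p)"
      by (simp add: awalk_cost_def sum_list_triv)
  qed
  then show ?thesis
    by (cases "graph_dist G u v") auto
qed

section \<open>The cycle of length seven\<close>

lemma cycle_graph_simps [simp]:
  "pverts (cycle_graph n) = {..<n}"
  "(i, j) \<in> parcs (cycle_graph n) \<longleftrightarrow> i < n \<and> j < n \<and> (j = Suc i mod n \<or> i = Suc j mod n)"
  by (auto simp: cycle_graph_def)

lemma pair_wf_digraph_cycle_graph:
  assumes "n \<ge> 3"
  shows "pair_wf_digraph (cycle_graph n)"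
  using pair_graph_cycle_graph[OF assms] by (intro pair_graph.axioms pair_fin_digraph.axioms pair_digraph.axioms)

lemma cycle_graph_relpow:
  assumes "u < n"
  shows "(u, (u + k) mod n) \<in> parcs (cycle_graph n) ^^ k"
    and "((u + k) mod n, u) \<in> parcs (cycle_graph n) ^^ k"
proof -
  have step: "((u + k) mod n, (u + Suc k) mod n) \<in> parcs (cycle_graph n)"
    "((u + Suc k) mod n, (u + k) mod n) \<in> parcs (cycle_graph n)" for k
    using assms by (auto simp: mod_Suc_eq)
  show "(u, (u + k) mod n) \<in> parcs (cycle_graph n) ^^ k"
  proof (induction k)
    case (Suc k)
    then show ?case using step(1) by (rule relpow_Suc_I)
  qed (use assms in simp)
  show "((u + k) mod n, u) \<in> parcs (cycle_graph n) ^^ k"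
  proof (induction k)
    case (Suc k)
    with step(2) show ?case by (rule relpow_Suc_I2)
  qed (use assms in simp)
qed

lemma nat_less_7: "(n::nat) < 7 \<longleftrightarrow> n = 0 \<or> n = 1 \<or> n = 2 \<or> n = 3 \<or> n = 4 \<or> n = 5 \<or> n = 6"
  by auto

lemma graph_dist_cycle_7_le:
  assumes "u < 7" "v < 7"
  shows "graph_dist (cycle_graph 7) u v \<le> 3"
proof -
  have "\<exists>k\<le>3. v = (u + k) mod 7 \<or> u = (v + k) mod 7"
  proof -
    have "\<exists>k\<le>3. y = (x + k) mod 7 \<or> x = (y + k) mod 7" if "x \<le> y" "y < 7" for x y :: nat
    proof (cases "y \<le> x + 3")
      case True
      with that show ?thesis by (intro exI[of _ "y - x"]) auto
    next
      case False
      \<comment> \<open>Going on from \<open>y\<close> past the wrap-around reaches \<open>x\<close>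
        after \<open>7 + x - y \<le> 3\<close> steps.\<close>
      moreover have "y + (7 + x - y) = 7 + x" using that by simp
      ultimately show ?thesis
        using that by (intro exI[of _ "7 + x - y"]) auto
    qed
    from this[of u v] this[of v u] show ?thesis
      using assms by (meson nat_le_linear)
  qed
  then obtain k where "k \<le> 3" and k: "v = (u + k) mod 7 \<or> u = (v + k) mod 7"
    by blast
  then have "(u, v) \<in> parcs (cycle_graph 7) ^^ k"
    using cycle_graph_relpow assms by blast
  then have "graph_dist (cycle_graph 7) u v \<le> real k"
    using assms by (intro graph_dist_le_relpow pair_wf_digraph_cycle_graph) auto
  also have "\<dots> \<le> 3"
    using \<open>k \<le> 3\<close> by simp
  finally show ?thesis by simp
qed

lemma graph_dist_cycle_7_antipodal:
  assumes "u \<in> {3, 4}"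
  shows "graph_dist (cycle_graph 7) u 0 = 3"
proof (rule antisym)
  show "graph_dist (cycle_graph 7) u 0 \<le> 3"
    using assms by (intro graph_dist_cycle_7_le) auto
  \<comment> \<open>The potential is the length of the shorter way to \<open>0\<close>; it equals 3
    at both \<open>3\<close> and \<open>4\<close>.\<close>
  have "real (min u (7 - u)) \<le> graph_dist (cycle_graph 7) u 0 + real (min 0 (7 - 0))"
    by (rule graph_dist_ge_potential)
      (auto simp: pair_wf_digraph_cycle_graph mod_Suc split: if_splits)
  then show "graph_dist (cycle_graph 7) u 0 \<ge> 3"
    using assms by auto
qed

lemma graph_diameter_cycle_7: "graph_diameter (cycle_graph 7) = 3"
  unfolding graph_diameter_def
proof (rule antisym)
  show "(SUP (u, v)\<in>pverts (cycle_graph 7) \<times> pverts (cycle_graph 7).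
      graph_dist (cycle_graph 7) u v) \<le> 3"
    using graph_dist_cycle_7_le by (intro SUP_least) auto
  have "graph_dist (cycle_graph 7) 3 0 = 3"
    by (rule graph_dist_cycle_7_antipodal) simp
  then show "3 \<le> (SUP (u, v)\<in>pverts (cycle_graph 7) \<times> pverts (cycle_graph 7).
      graph_dist (cycle_graph 7) u v)"
    by (intro SUP_upper2[of "(3, 0)"]) auto
qed

section \<open>Sufficient weights and upper bounds\<close>

text \<open>Either direction gives a path of seven vertices ending in the root, hence the threshold
  \<open>2 ^ 6 = 64\<close>; \<open>k\<close> is the offset from \<open>r\<close>.\<close>

lemma solvable_cycle_7:
  assumes "r < 7"
    and "64 \<le> path_weight (\<lambda>k. D ((r + k) mod 7)) [6, 5, 4, 3, 2, 1, 0] \<or>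
      64 \<le> path_weight (\<lambda>k. D ((r + k) mod 7)) [1, 2, 3, 4, 5, 6, 0]"
  shows "solvable (cycle_graph 7) r D"
proof -
  have *: "solvable (cycle_graph 7) r D"
    if "64 \<le> path_weight (\<lambda>k. D ((r + k) mod 7)) vs"
      and vs: "vs = [6, 5, 4, 3, 2, 1, 0] \<or> vs = [1, 2, 3, 4, 5, 6, 0]" for vs
  proof -
    let ?vs = "map (\<lambda>k. (r + k) mod 7) vs"
    have "successively (\<lambda>a b. (a, b) \<in> parcs (cycle_graph 7)) ?vs \<and> distinct ?vs"
      using vs assms(1) unfolding nat_less_7 by (elim disjE) simp_all
    moreover have "2 ^ (length ?vs - 1) \<le> path_weight D ?vs"
      using that by (auto simp: path_weight_map comp_def)
    moreover have "last ?vs = r" "?vs \<noteq> []"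
      using vs assms(1) by auto
    ultimately show ?thesis
      using solvable_path[of "cycle_graph 7" ?vs D] by simp
  qed
  then show ?thesis using assms(2) by blast
qed

text \<open>The two weights add up to at least \<open>12\<close> per pebble.\<close>

lemma redundant_pebble_cycle_7:
  fixes y :: "nat \<Rightarrow> nat"
  assumes "11 \<le> (\<Sum>k<7. y k)"
  obtains k where "k < 7" "1 \<le> y k"
    "64 \<le> path_weight (y(k := y k - 1)) [6, 5, 4, 3, 2, 1, 0] \<or>
     64 \<le> path_weight (y(k := y k - 1)) [1, 2, 3, 4, 5, 6, 0]"
proof -
  let ?f = "path_weight y [6, 5, 4, 3, 2, 1, 0]" and ?g = "path_weight y [1, 2, 3, 4, 5, 6, 0]"
  have s: "11 \<le> y 0 + y 1 + y 2 + y 3 + y 4 + y 5 + y 6"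
    using assms by (simp add: lessThan_nat_numeral lessThan_Suc)
  have weights:
    "?f = y 6 + 2 * y 5 + 4 * y 4 + 8 * y 3 + 16 * y 2 + 32 * y 1 + 64 * y 0"
    "?g = y 1 + 2 * y 2 + 4 * y 3 + 8 * y 4 + 16 * y 5 + 32 * y 6 + 64 * y 0"
    by simp_all
  have "\<exists>k<7. 1 \<le> y k \<and> (64 \<le> path_weight (y(k := y k - 1)) [6, 5, 4, 3, 2, 1, 0] \<or>
     64 \<le> path_weight (y(k := y k - 1)) [1, 2, 3, 4, 5, 6, 0])"
  proof (rule ccontr)
    assume "\<not> ?thesis"
    then have *: "path_weight (y(k := y k - 1)) [6, 5, 4, 3, 2, 1, 0] < 64 \<and>
      path_weight (y(k := y k - 1)) [1, 2, 3, 4, 5, 6, 0] < 64" if "k < 7" "1 \<le> y k" for k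
      using that by (auto simp: not_le)
    \<comment> \<open>Each bound is 64 plus the weight of the removed pebble; \<open>w\<close> uses
      32, the largest weight at its four vertices.\<close>
    have w0: "?f < 128 \<and> ?g < 128" if "1 \<le> y 0"
      using *[of 0] that by (cases "y 0") simp_all
    have w3: "?f < 72 \<and> ?g < 68" if "1 \<le> y 3"
      using *[of 3] that by (cases "y 3") simp_all
    have w4: "?f < 68 \<and> ?g < 72" if "1 \<le> y 4"
      using *[of 4] that by (cases "y 4") simp_all
    have w: "?f < 96 \<and> ?g < 96" if "k \<in> {1, 2, 5, 6}" "1 \<le> y k" for k
      using that *[of k] by (cases "y k") auto
    \<comment> \<open>A pebble on \<open>3\<close> or \<open>4\<close> has joint weight 12,
      elsewhere at least 18, so the split is by which of the two is occupied.\<close>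
    consider "1 \<le> y 0" "y 3 = 0" "y 4 = 0" | "y 0 = 0" "y 3 = 0" "y 4 = 0"
      | "1 \<le> y 3" "y 4 = 0" | "y 3 = 0" "1 \<le> y 4" | "1 \<le> y 3" "1 \<le> y 4"
      by linarith
    then show False
    proof cases
      case 1
      then have "?f < 128" "?g < 128" using w0 by blast+
      with s 1 show ?thesis unfolding weights by linarith
    next
      case 2
      with s have "1 \<le> y 1 \<or> 1 \<le> y 2 \<or> 1 \<le> y 5 \<or> 1 \<le> y 6" by linarith
      then have "?f < 96" "?g < 96" using w by blast+
      with s 2 show ?thesis unfolding weights by linarith
    next
      case 3
      with w3 have "?f < 72" "?g < 68" by blast+
      with s 3 show ?thesis unfolding weights by linarith
    next
      case 4
      with w4 have "?f < 68" "?g < 72" by blast+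
      with s 4 show ?thesis unfolding weights by linarith
    next
      case 5
      with w3 w4 have fg: "?f < 68" "?g < 68" by blast+
      \<comment> \<open>Here \<open>?f + ?g \<le> 134\<close>, but eleven pebbles with one off
        \<open>3\<close> and \<open>4\<close> would give at least \<open>132 + 6\<close>.\<close>
      then have "y 0 = 0 \<and> y 1 = 0 \<and> y 2 = 0 \<and> y 5 = 0 \<and> y 6 = 0"
        using s unfolding weights by linarith
      \<comment> \<open>Integrality matters: piles of 5.5 each would satisfy both weight
        bounds.\<close>
      moreover from this have "y 3 \<le> 5" "y 4 \<le> 5"
        using s fg unfolding weights by linarith+
      ultimately show ?thesis using s by linarith
    qed
  qed
  then show thesis by (elim exE conjE) (rule that)
qed

lemma bij_betw_rotate_mod:
  assumes "0 < n"
  shows "bij_betw (\<lambda>k. (r + k) mod n) {..<n} {..<n::nat}"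
proof -
  have "inj_on (\<lambda>k. (r + k) mod n) {..<n}"
  proof (rule linorder_inj_onI')
    fix i j assume "i \<in> {..<n}" "j \<in> {..<n}" "i < j"
    then have "\<not> n dvd (r + j) - (r + i)"
      by (auto dest: dvd_imp_le)
    then show "(r + i) mod n \<noteq> (r + j) mod n"
      using \<open>i < j\<close> by (metis add_le_mono1 add.commute less_imp_le mod_eq_dvd_iff_nat)
  qed
  moreover from this have "(\<lambda>k. (r + k) mod n) ` {..<n} = {..<n}"
    using assms by (intro endo_inj_surj) auto
  ultimately show ?thesis
    by (simp add: bij_betw_def)
qed

text \<open>Transfers the redundant pebble from offsets to vertices. Solvability of \<open>D\<close>
  serves the pebbling number, the removable pebble the bound on critical distributions.\<close>

lemma removable_pebble_cycle_7:
  assumes "r < 7" "11 \<le> num_pebbles (cycle_graph 7) D"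
  obtains v where "1 \<le> D v" "solvable (cycle_graph 7) r (D(v := D v - 1))"
    "solvable (cycle_graph 7) r D"
proof -
  let ?f = "\<lambda>k. (r + k) mod 7"
  have bij: "bij_betw ?f {..<7} {..<7}"
    by (rule bij_betw_rotate_mod) simp
  have "num_pebbles (cycle_graph 7) D = (\<Sum>k<7. D (?f k))"
    by (simp add: num_pebbles_def sum.reindex_bij_betw[OF bij])
  with assms(2) have "11 \<le> (\<Sum>k<7. D (?f k))" by simp
  then obtain k where k: "k < 7" "1 \<le> D (?f k)"
    and *: "64 \<le> path_weight ((\<lambda>k. D (?f k))(k := D (?f k) - 1)) [6, 5, 4, 3, 2, 1, 0] \<or>
      64 \<le> path_weight ((\<lambda>k. D (?f k))(k := D (?f k) - 1)) [1, 2, 3, 4, 5, 6, 0]"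
    by (rule redundant_pebble_cycle_7)
  let ?E = "D(?f k := D (?f k) - 1)"
  \<comment> \<open>The two updates agree only on offsets below 7, where \<open>?f\<close> is
    injective.\<close>
  have eq: "path_weight ((\<lambda>k. D (?f k))(k := D (?f k) - 1)) vs = path_weight (\<lambda>k. ?E (?f k)) vs"
    if "set vs \<subseteq> {..<7}" for vs
  proof (rule path_weight_cong)
    fix j assume "j \<in> set vs"
    with that k(1) have "?f j = ?f k \<longleftrightarrow> j = k"
      by (intro inj_on_eq_iff[OF bij_betw_imp_inj_on[OF bij]]) auto
    then show "((\<lambda>k. D (?f k))(k := D (?f k) - 1)) j = ?E (?f j)"
      by (simp only: fun_upd_apply)
  qed
  have le: "path_weight (\<lambda>k. ?E (?f k)) vs \<le> path_weight (\<lambda>k. D (?f k)) vs" for vs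
    by (rule path_weight_mono) auto
  have E: "64 \<le> path_weight (\<lambda>k. ?E (?f k)) [6, 5, 4, 3, 2, 1, 0] \<or>
      64 \<le> path_weight (\<lambda>k. ?E (?f k)) [1, 2, 3, 4, 5, 6, 0]"
    using * eq[of "[6, 5, 4, 3, 2, 1, 0]"] eq[of "[1, 2, 3, 4, 5, 6, 0]"]
    by (simp del: path_weight.simps fun_upd_apply)
  show thesis
  proof (rule that)
    show "solvable (cycle_graph 7) r ?E"
      using assms(1) E by (rule solvable_cycle_7)
    show "solvable (cycle_graph 7) r D"
      using assms(1)
    proof (rule solvable_cycle_7)
      show "64 \<le> path_weight (\<lambda>k. D (?f k)) [6, 5, 4, 3, 2, 1, 0] \<or>
          64 \<le> path_weight (\<lambda>k. D (?f k)) [1, 2, 3, 4, 5, 6, 0]"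
        using E by (rule disj_forward) (erule order_trans, rule le)+
    qed
  qed (fact k(2))
qed

lemma pebbling_number_cycle_7_le: "pebbling_number (cycle_graph 7) \<le> 11"
  unfolding pebbling_number_def
  by (rule Least_le) (metis cycle_graph_simps(1) lessThan_iff order_refl removable_pebble_cycle_7)

lemma num_pebbles_critical_cycle_7_le:
  assumes "r < 7" "critical (cycle_graph 7) r D"
  shows "num_pebbles (cycle_graph 7) D \<le> 10"
proof (rule ccontr)
  assume "\<not> num_pebbles (cycle_graph 7) D \<le> 10"
  then have "11 \<le> num_pebbles (cycle_graph 7) D" by simp
  with assms(1) obtain v where "1 \<le> D v" "solvable (cycle_graph 7) r (D(v := D v - 1))"
    by (rule removable_pebble_cycle_7)
  with assms(2) show False by (auto simp: critical_def)
qed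

section \<open>Weight invariants against solutions\<close>

text \<open>Puts a step into a form for case analysis: \<open>a + 6\<close> is the predecessor
  modulo 7, and \<open>m + 2\<close> resolves the truncated subtraction.\<close>

lemma pebbling_step_cycle_7E:
  assumes "pebbling_step (cycle_graph 7) a b E E'"
  obtains m where "a < 7" "b = Suc a mod 7 \<or> b = (a + 6) mod 7" "E a = m + 2"
    "E' = E(a := E a - 2, b := E b + 1)"
proof -
  have "a < 7" "b = Suc a mod 7 \<or> b = (a + 6) mod 7" "2 \<le> E a"
    "E' = E(a := E a - 2, b := E b + 1)"
    using assms by (auto simp: pebbling_step_def mod_Suc split: if_splits)
  moreover from this have "E a = E a - 2 + 2" by simp
  ultimately show thesis by (intro that[of "E a - 2"])
qed

text \<open>A pebbling step between two non-root vertices increases neither weight, and a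
  step onto the root needs two pebbles next to it, which already have weight \<open>64\<close>.\<close>

lemma not_solvable_cycle_7:
  assumes "path_weight D [6, 5, 4, 3, 2, 1, 0] < 64" "path_weight D [1, 2, 3, 4, 5, 6, 0] < 64"
  shows "\<not> solvable (cycle_graph 7) 0 D"
proof
  assume "solvable (cycle_graph 7) 0 D"
  then obtain E where steps: "(\<lambda>E E'. \<exists>a b. pebbling_step (cycle_graph 7) a b E E')\<^sup>*\<^sup>* D E"
    and "1 \<le> E 0"
    by (auto simp: solvable_def)
  \<comment> \<open>The bounds must be carried together: a step from \<open>6\<close> onto the root
    raises the first weight and is excluded by the second; for \<open>1\<close> it is the
    reverse.\<close>
  from steps have "path_weight E [6, 5, 4, 3, 2, 1, 0] < 64 \<and>
    path_weight E [1, 2, 3, 4, 5, 6, 0] < 64"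
  proof (induction rule: rtranclp_induct)
    case base
    then show ?case using assms by simp
  next
    case (step E E')
    then obtain a b where "pebbling_step (cycle_graph 7) a b E E'" by blast
    then obtain m where "a < 7" and b: "b = Suc a mod 7 \<or> b = (a + 6) mod 7"
      and m: "E a = m + 2" and E': "E' = E(a := E a - 2, b := E b + 1)"
      by (rule pebbling_step_cycle_7E)
    from \<open>a < 7\<close> b m step.IH show ?case
      unfolding nat_less_7 E' by (elim disjE) (simp_all, linarith?)
  qed
  with \<open>1 \<le> E 0\<close> show False by simp
qed

text \<open>Greedy steps cannot use the edge between the two vertices farthest from the root,
  so the two sides of the cycle stay separate.\<close>

lemma not_greedy_distribution_cycle_7:
  assumes "path_weight D [3, 2, 1, 0] < 8" "path_weight D [4, 5, 6, 0] < 8"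
  shows "\<not> greedy_distribution (cycle_graph 7) 0 D"
proof
  assume "greedy_distribution (cycle_graph 7) 0 D"
  then obtain E where steps: "(\<lambda>E E'. \<exists>a b. greedy_step (cycle_graph 7) 0 a b E E')\<^sup>*\<^sup>* D E"
    and "1 \<le> E 0"
    by (auto simp: greedy_distribution_def)
  from steps have "path_weight E [3, 2, 1, 0] < 8 \<and> path_weight E [4, 5, 6, 0] < 8"
  proof (induction rule: rtranclp_induct)
    case base
    then show ?case using assms by simp
  next
    case (step E E')
    then obtain a b where "greedy_step (cycle_graph 7) 0 a b E E'" by blast
    \<comment> \<open>Both \<open>3\<close> and \<open>4\<close> have distance 3 from the root, so a
      step between them is not strictly decreasing.\<close>
    then have step': "pebbling_step (cycle_graph 7) a b E E'"
      and far: "\<not> (a \<in> {3, 4} \<and> b \<in> {3, 4})"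
      by (auto simp: greedy_step_def graph_dist_cycle_7_antipodal)
    from step' obtain m where "a < 7" and b: "b = Suc a mod 7 \<or> b = (a + 6) mod 7"
      and m: "E a = m + 2" and E': "E' = E(a := E a - 2, b := E b + 1)"
      by (rule pebbling_step_cycle_7E)
    from \<open>a < 7\<close> b far m step.IH show ?case
      unfolding nat_less_7 E' by (elim disjE) (simp_all, linarith?)
  qed
  with \<open>1 \<le> E 0\<close> show False by simp
qed

section \<open>The extremal distributions\<close>

definition two_piles :: "nat \<Rightarrow> nat \<Rightarrow> nat \<Rightarrow> nat" where
  "two_piles x y = (\<lambda>_. 0)(3 := x, 4 := y)"

lemma num_pebbles_two_piles: "num_pebbles (cycle_graph 7) (two_piles x y) = x + y"
  by (simp add: num_pebbles_def two_piles_def numeral_eq_Suc)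

lemma distribution_two_piles: "distribution (cycle_graph 7) (two_piles x y)"
  by (simp add: distribution_def two_piles_def)

text \<open>The two weights are 64 and 56; removing a pebble from \<open>3\<close> leaves 56 and 52,
  from \<open>4\<close> leaves 60 and 48.\<close>

lemma critical_two_piles: "critical (cycle_graph 7) 0 (two_piles 6 4)"
  unfolding critical_def
proof (intro conjI allI impI)
  show "solvable (cycle_graph 7) 0 (two_piles 6 4)"
    by (rule solvable_cycle_7) (simp_all add: two_piles_def)
  fix v assume "1 \<le> two_piles 6 4 v"
  then have "v = 3 \<or> v = 4"
    by (auto simp: two_piles_def split: if_splits)
  then show "\<not> solvable (cycle_graph 7) 0 ((two_piles 6 4)(v := two_piles 6 4 v - 1))"
    by (intro not_solvable_cycle_7) (auto simp: two_piles_def)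
qed (fact distribution_two_piles)

lemma critical_number_cycle_7: "critical_number (cycle_graph 7) = 10"
  unfolding critical_number_def
proof (rule Max_eqI)
  let ?S = "{num_pebbles (cycle_graph 7) D |D r. r \<in> pverts (cycle_graph 7) \<and> critical (cycle_graph 7) r D}"
  show le: "n \<le> 10" if "n \<in> ?S" for n
    using that num_pebbles_critical_cycle_7_le by auto
  then show "finite ?S"
    by (intro finite_subset[of ?S "{..10}"]) auto
  show "10 \<in> ?S"
    by (intro CollectI exI[of _ "two_piles 6 4"] exI[of _ 0] conjI critical_two_piles)
      (simp_all add: num_pebbles_two_piles)
qed

lemma not_greedy_two_piles:
  assumes "x < 8" "y < 8"
  shows "\<not> greedy_distribution (cycle_graph 7) 0 (two_piles x y)"
  using assms by (intro not_greedy_distribution_cycle_7) (simp_all add: two_piles_def)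

theorem theorem17:
  shows "\<not> thrifty (cycle_graph 7) \<and> \<not> greedy_graph (cycle_graph 7) \<and>
    graph_diameter (cycle_graph 7) = 3 \<and> critical_number (cycle_graph 7) > 2 ^ 3"
proof (intro conjI)
  have "ceiling_distribution (cycle_graph 7) 0 (two_piles 6 4)"
    by (simp add: ceiling_distribution_def critical_two_piles critical_number_cycle_7
        num_pebbles_two_piles)
  then show "\<not> thrifty (cycle_graph 7)"
    using not_greedy_two_piles[of 6 4] by (auto simp: thrifty_def)
  \<comment> \<open>An upper bound on the pebbling number suffices, since the counterexample needs
    only at least that many pebbles.\<close>
  have "pebbling_number (cycle_graph 7) \<le> num_pebbles (cycle_graph 7) (two_piles 7 4)"
    using pebbling_number_cycle_7_le by (simp add: num_pebbles_two_piles)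
  then show "\<not> greedy_graph (cycle_graph 7)"
    using not_greedy_two_piles[of 7 4] distribution_two_piles[of 7 4]
    by (auto simp: greedy_graph_def)
qed (simp_all add: graph_diameter_cycle_7 critical_number_cycle_7)

end
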